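(* Let $\mathcal{D}$ be a nonempty difference set in a finite abelian group $\mathcal{G}$ (written additively). The corresponding harmonic ETF is axial if $0\in\mathcal{D}$ and is centered otherwise. In particular, if there exists an $m$-element difference set (with $m\ge1$) in an abelian group of order $n>m$, then there exist centered ETFs of $n$ vectors for $\mathbb{C}^m$ as well as axial ETFs of $n$ vectors for $\mathbb{C}^m$.
   Context: For vectors $\{\varphi_i\}_{i=1}^n$ in $\mathbb{C}^m$, the synthesis operator $\Phi$ is the $m\times n$ matrix whose $i$th column is $\varphi_i$. The sequence is an equiangular tight frame (ETF) for $\mathbb{C}^m$ if every $\varphi_i$ has unit norm, $|\langle\varphi_i,\varphi_j\rangle|$ is constant over all $i\neq j$, and $\Phi\Phi^*=\alpha I$ for some $\alpha>0$ (necessarily $\alpha=\frac nm$). Let $\mathbf{1}$ be the all-ones vector. An ETF is centered if $\mathbf{1}$ lies in the null space of $\Phi$ (equivalently $\Phi^*\Phi\mathbf{1}=\mathbf{0}$); it is axial if $\mathbf{1}$ lies in the column space of $\Phi^*$ (equivalently $\Phi^*\Phi\mathbf{1}=\frac nm\mathbf{1}$). A subset $\mathcal{D}$ of a finite abelian group $\mathcal{G}$ is a difference set if the cardinality of $\{(d,d')\in\mathcal{D}\times\mathcal{D}: g=d-d'\}$ is the same for all $g\neq0$ in $\mathcal{G}$. Let $\{g_i\}_{i=1}^n$ and $\{\gamma_j\}_{j=1}^n$ be enumerations of $\mathcal{G}$ and of its Pontryagin dual (the group of characters $\mathcal{G}\to\{z\in\mathbb{C}:|z|=1\}$), respectively.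 For an $m$-element difference set $\mathcal{D}=\{g_{i_k}\}_{k=1}^m$, the corresponding harmonic ETF is the sequence of columns of the $m\times n$ matrix $\Phi$ with entries $\Phi(k,j)=\frac1{\sqrt m}\gamma_j(g_{i_k})$; it is known that these columns form an ETF for $\mathbb{C}^m$ precisely because $\mathcal{D}$ is a difference set. *)

theory Defs
  imports
    "HOL-Library.Cardinality"
    "HOL-Analysis.L2_Norm"
    "Jordan_Normal_Form.Matrix_Kernel"
    "Jordan_Normal_Form.Schur_Decomposition"
    "Jordan_Normal_Form.VS_Connect"
begin

(* A sequence of n vectors in C^m is a list of length n of elements of carrier_vec m.
   Its synthesis operator is mat_of_cols m phi, the m x n matrix with these columns.
   All indices are 0-based. *)

definition vec_norm :: "complex vec \<Rightarrow> real" where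
  "vec_norm v = L2_set (\<lambda>k. cmod (v $ k)) {..<dim_vec v}"

definition is_ETF :: "nat \<Rightarrow> complex vec list \<Rightarrow> bool" where
  "is_ETF m \<phi> \<longleftrightarrow>
     set \<phi> \<subseteq> carrier_vec m \<and>
     (\<forall>i < length \<phi>. vec_norm (\<phi> ! i) = 1) \<and>
     (\<exists>c. \<forall>i < length \<phi>. \<forall>j < length \<phi>. i \<noteq> j \<longrightarrow> cmod (\<phi> ! i \<bullet>c \<phi> ! j) = c) \<and>
     (\<exists>\<alpha>::real. \<alpha> > 0 \<and>
        mat_of_cols m \<phi> * mat_adjoint (mat_of_cols m \<phi>) = complex_of_real \<alpha> \<cdot>\<^sub>m 1\<^sub>m m)"

definition all_ones :: "nat \<Rightarrow> complex vec" where
  "all_ones n = vec n (\<lambda>_. 1)"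

definition centered_ETF :: "nat \<Rightarrow> complex vec list \<Rightarrow> bool" where
  "centered_ETF m \<phi> \<longleftrightarrow>
     is_ETF m \<phi> \<and> all_ones (length \<phi>) \<in> mat_kernel (mat_of_cols m \<phi>)"

(* The dimension argument of col_space is that of the ambient space C^n, n = length phi. *)
definition axial_ETF :: "nat \<Rightarrow> complex vec list \<Rightarrow> bool" where
  "axial_ETF m \<phi> \<longleftrightarrow>
     is_ETF m \<phi> \<and>
     all_ones (length \<phi>) \<in>
       vec_space.col_space (length \<phi>) (mat_adjoint (mat_of_cols m \<phi>))"

definition difference_set :: "'g::{finite, ab_group_add} set \<Rightarrow> bool" where
  "difference_set D \<longleftrightarrow>
     (\<exists>l. \<forall>g. g \<noteq> 0 \<longrightarrow> card {(d, d'). d \<in> D \<and> d' \<in> D \<and> g = d - d'} = l)"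

definition pontryagin_dual :: "('g::{finite, ab_group_add} \<Rightarrow> complex) set" where
  "pontryagin_dual = {\<chi>. (\<forall>a. cmod (\<chi> a) = 1) \<and> (\<forall>a b. \<chi> (a + b) = \<chi> a * \<chi> b)}"

(* g enumerates the group, \<gamma> its dual, and i lists the m indices of the elements of the
   difference set in the enumeration g. *)
definition harmonic_ETF ::
    "nat \<Rightarrow> nat \<Rightarrow> (nat \<Rightarrow> 'g) \<Rightarrow> (nat \<Rightarrow> 'g \<Rightarrow> complex) \<Rightarrow> (nat \<Rightarrow> nat) \<Rightarrow> complex vec list" where
  "harmonic_ETF m n g \<gamma> i =
     cols (mat m n (\<lambda>(k, j). complex_of_real (1 / sqrt (real m)) * \<gamma> j (g (i k))))"

end

theory Submission
  imports Defs
begin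

text \<open>
  A character of a subgroup \<open>H\<close> extends to \<open>H + \<int>x\<close>: if \<open>kx\<close> is the first positive multiple of
  \<open>x\<close> in \<open>H\<close>, any \<open>k\<close>-th root of the character's value at \<open>kx\<close> is an admissible value at \<open>x\<close>.
  Hence characters separate points, both orthogonality relations hold, and summing all values
  of all characters in two ways shows that the dual of \<open>G\<close> has \<open>|G|\<close> elements.
  If each nonzero element is \<open>l\<close> times a difference of elements of \<open>D\<close>, orthogonality gives
  \<open>|\<Sum>d\<in>D. \<chi> d|\<^sup>2 = |D| - l\<close> for nontrivial \<open>\<chi>\<close>, hence equiangularity. The \<open>k\<close>-th row of the synthesis operator lists the values
  of all characters at the \<open>k\<close>-th element of \<open>D\<close>: it is constant if this element is \<open>0\<close>, and
  orthogonal to the all-ones vector otherwise. Translating \<open>D\<close> moves \<open>0\<close> in or out of it.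
\<close>

section \<open>Multiples, subgroups and their characters\<close>

primrec nat_mult :: "nat \<Rightarrow> 'a::monoid_add \<Rightarrow> 'a" where
  "nat_mult 0 x = 0"
| "nat_mult (Suc j) x = x + nat_mult j x"

lemma nat_mult_add: "nat_mult (i + j) x = nat_mult i x + nat_mult j x"
  by (induction i) (simp_all add: add.assoc)

lemma sum_const_nat_mult:
  fixes x :: "'a::comm_monoid_add"
  shows "finite A \<Longrightarrow> (\<Sum>a\<in>A. x) = nat_mult (card A) x"
  by (induction A rule: finite_induct) auto

lemma bij_plus_right: "bij (\<lambda>y. y + x)" for x :: "'a::group_add"
  by (rule bij_betw_byWitness[where f' = "\<lambda>y. y - x"]) auto

text \<open>Translation by \<open>x\<close> permutes the group, so adding \<open>x\<close> to every
  element leaves the sum of all elements unchanged; cancelling that sum leaves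
  \<open>CARD('g)\<close> copies of \<open>x\<close>.\<close>

lemma nat_mult_CARD: "nat_mult CARD('g) (x :: 'g::{finite, ab_group_add}) = 0"
proof -
  have "(\<Sum>y\<in>UNIV. y) = (\<Sum>y\<in>UNIV. y + x)"
    using sum.reindex_bij_betw[OF bij_plus_right[of x], of "\<lambda>y. y"] by simp
  then show ?thesis
    by (simp add: sum.distrib sum_const_nat_mult)
qed

text \<open>Closure under negation is automatic in a finite group.\<close>

definition subgrp :: "'g::ab_group_add set \<Rightarrow> bool" where
  "subgrp H \<longleftrightarrow> 0 \<in> H \<and> (\<forall>a\<in>H. \<forall>b\<in>H. a + b \<in> H)"

definition char_on :: "'g::ab_group_add set \<Rightarrow> ('g \<Rightarrow> complex) \<Rightarrow> bool" where
  "char_on H \<chi> \<longleftrightarrow> (\<forall>a\<in>H. cmod (\<chi> a) = 1) \<and> (\<forall>a\<in>H. \<forall>b\<in>H. \<chi> (a + b) = \<chi> a * \<chi> b)"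

text \<open>Translation by \<open>a\<close> maps \<open>H\<close> injectively into itself, hence
  onto itself by finiteness; the preimage of \<open>0\<close> is the inverse of
  \<open>a\<close>.\<close>

lemma subgrp_uminus:
  fixes H :: "'g::{finite, ab_group_add} set"
  assumes "subgrp H" "a \<in> H"
  shows "- a \<in> H"
proof -
  have "(\<lambda>y. y + a) ` H = H"
    using assms by (intro endo_inj_surj) (auto simp: subgrp_def inj_on_def)
  then obtain y where "y \<in> H" "y + a = 0"
    using assms(1) by (metis (no_types, lifting) imageE subgrp_def)
  then show ?thesis
    by (metis minus_unique add.commute)
qed

lemma subgrp_diff:
  fixes H :: "'g::{finite, ab_group_add} set"
  assumes "subgrp H" "a \<in> H" "b \<in> H"
  shows "a - b \<in> H"
  using assms subgrp_uminus[OF assms(1,3)] by (metis subgrp_def diff_conv_add_uminus)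

lemma char_on_zero:
  assumes "subgrp H" "char_on H \<chi>"
  shows "\<chi> 0 = 1"
proof -
  have "\<chi> 0 * \<chi> 0 = \<chi> 0" "\<chi> 0 \<noteq> 0"
    using assms unfolding subgrp_def char_on_def by (metis add_0, force)
  then show ?thesis by simp
qed

section \<open>Extension of characters\<close>

lemma nat_mult_mult_mem:
  assumes "subgrp H" "char_on H \<chi>" "nat_mult k x \<in> H"
  shows "nat_mult (k * q) x \<in> H \<and> \<chi> (nat_mult (k * q) x) = \<chi> (nat_mult k x) ^ q"
proof (induction q)
  case 0
  then show ?case using assms char_on_zero[OF assms(1,2)] by (auto simp: subgrp_def)
next
  case (Suc q)
  then show ?case
    using assms by (simp add: nat_mult_add subgrp_def char_on_def)
qed

text \<open>Take the least positive \<open>k\<close> with \<open>k x\<close> in \<open>H\<close>;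
  the group order shows that one exists. If \<open>j x\<close> lies in \<open>H\<close>, so does
  \<open>(j mod k) x\<close>, and minimality forces the remainder to be zero.\<close>

lemma subgrp_multiples:
  fixes H :: "'g::{finite, ab_group_add} set"
  assumes H: "subgrp H"
  obtains k where "k > 0" "nat_mult k x \<in> H" "\<And>j. nat_mult j x \<in> H \<Longrightarrow> k dvd j"
proof -
  define k where "k = (LEAST k. k > 0 \<and> nat_mult k x \<in> H)"
  have ex: "CARD('g) > 0 \<and> nat_mult CARD('g) x \<in> H"
    using H by (simp add: nat_mult_CARD subgrp_def)
  have k: "k > 0" "nat_mult k x \<in> H"
    using LeastI[where P = "\<lambda>k. k > 0 \<and> nat_mult k x \<in> H", OF ex] by (auto simp: k_def)
  have "k dvd j" if j: "nat_mult j x \<in> H" for j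
  proof (rule ccontr)
    assume "\<not> k dvd j"
    then have r: "j mod k > 0" by (simp add: mod_greater_zero_iff_not_dvd)
    \<comment> \<open>The trivial character gives access to \<open>nat_mult_mult_mem\<close>, of
      which only the membership half is wanted here.\<close>
    have "char_on H (\<lambda>_. 1)" by (simp add: char_on_def)
    then have q: "nat_mult (k * (j div k)) x \<in> H"
      using nat_mult_mult_mem[OF H _ k(2)] by blast
    have "nat_mult j x = nat_mult (k * (j div k)) x + nat_mult (j mod k) x"
      by (metis nat_mult_add mult_div_mod_eq)
    then have "nat_mult (j mod k) x = nat_mult j x - nat_mult (k * (j div k)) x"
      by simp
    then have "nat_mult (j mod k) x \<in> H"
      using subgrp_diff[OF H j q] by simp
    then have "k \<le> j mod k"
      unfolding k_def using r[unfolded k_def] by (intro Least_le) auto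
    then show False using k(1) mod_less_divisor[of k j] by linarith
  qed
  with k show ?thesis using that by blast
qed

text \<open>The value \<open>w\<close> at \<open>x\<close> is left as a parameter: for extending
  characters any root will do, whereas separating points requires a root other than 1.\<close>

lemma char_on_extend_step:
  fixes H :: "'g::{finite, ab_group_add} set"
  assumes H: "subgrp H" and \<chi>: "char_on H \<chi>"
    and k: "k > 0" "nat_mult k x \<in> H" "\<And>j. nat_mult j x \<in> H \<Longrightarrow> k dvd j"
    and w: "w ^ k = \<chi> (nat_mult k x)"
  obtains H' \<chi>' where "subgrp H'" "char_on H' \<chi>'" "H \<subseteq> H'" "x \<in> H'"
    "\<And>h. h \<in> H \<Longrightarrow> \<chi>' h = \<chi> h" "\<chi>' x = w"
proof -
  \<comment> \<open>Well-definedness: if \<open>h + j x = h' + j' x\<close>, then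
    \<open>(j' - j) x\<close> is in \<open>H\<close>, so \<open>j' - j\<close> is a multiple of
    \<open>k\<close>, and the condition on \<open>w ^ k\<close> makes the two candidate values
    agree.\<close>
  have wd: "\<chi> h * w ^ j = \<chi> h' * w ^ j'"
    if "h \<in> H" "h' \<in> H" "h + nat_mult j x = h' + nat_mult j' x" "j \<le> j'" for h h' j j'
  proof -
    have "nat_mult j' x = nat_mult (j' - j) x + nat_mult j x"
      using that(4) by (metis nat_mult_add le_add_diff_inverse2)
    with that(3) have h: "h = h' + nat_mult (j' - j) x"
      by (metis add.assoc add_right_cancel)
    then have mem: "nat_mult (j' - j) x \<in> H"
      using subgrp_diff[OF H that(1,2)] by simp
    then obtain q where q: "j' - j = k * q" using k(3) by (auto elim: dvdE)
    have "\<chi> (nat_mult (j' - j) x) = w ^ (j' - j)"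
      using nat_mult_mult_mem[OF H \<chi> k(2), of q] by (simp add: q w[symmetric] power_mult)
    with h mem that(2) \<chi> have "\<chi> h = \<chi> h' * w ^ (j' - j)" by (simp add: char_on_def)
    with that(4) show ?thesis by (simp add: power_add[symmetric])
  qed
  \<comment> \<open>Natural multiples of \<open>x\<close> suffice, since in a finite group they
    include the negative ones.\<close>
  define H' where "H' = {h + nat_mult j x | h j. h \<in> H}"
  \<comment> \<open>The choice ranges over the values given by all representations of
    \<open>y\<close>; by \<open>wd\<close> these coincide for \<open>y\<close> in
    \<open>H'\<close>.\<close>
  define \<chi>' where "\<chi>' y = (SOME z. \<exists>h\<in>H. \<exists>j. y = h + nat_mult j x \<and> z = \<chi> h * w ^ j)" for y
  have val: "\<chi>' (h + nat_mult j x) = \<chi> h * w ^ j" if "h \<in> H" for h j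
  proof -
    have "\<exists>z. \<exists>h'\<in>H. \<exists>j'. h + nat_mult j x = h' + nat_mult j' x \<and> z = \<chi> h' * w ^ j'"
      using that by blast
    from someI_ex[OF this] obtain h' j' where
      "h' \<in> H" "h + nat_mult j x = h' + nat_mult j' x"
      "\<chi>' (h + nat_mult j x) = \<chi> h' * w ^ j'"
      unfolding \<chi>'_def by blast
    then show ?thesis using wd[OF that, of h' j j'] wd[of h' h j' j] that
      by (metis nle_le)
  qed
  \<comment> \<open>As a root of a unimodular number, \<open>w\<close> is unimodular, so the
    extended values are too.\<close>
  have "cmod w ^ k = 1" using w k(2) \<chi> by (metis char_on_def norm_power)
  then have cw: "cmod w = 1" using k(1) power_eq_imp_eq_base[of "cmod w" k 1] by simp
  have H0: "0 \<in> H" and Hadd: "\<And>a b. a \<in> H \<Longrightarrow> b \<in> H \<Longrightarrow> a + b \<in> H"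
    using H by (auto simp: subgrp_def)
  have comb: "(h + nat_mult j x) + (h' + nat_mult j' x) = (h + h') + nat_mult (j + j') x" for h h' j j'
    by (simp add: nat_mult_add algebra_simps)
  show ?thesis
  proof (rule that)
    have "0 + nat_mult 0 x \<in> H'" unfolding H'_def using H0 by blast
    moreover have "a + b \<in> H'" if "a \<in> H'" "b \<in> H'" for a b
      using that Hadd comb unfolding H'_def by blast
    ultimately show "subgrp H'" by (auto simp: subgrp_def)
    have "\<chi>' (a + b) = \<chi>' a * \<chi>' b" if ab: "a \<in> H'" "b \<in> H'" for a b
    proof -
      obtain h j h' j' where "h \<in> H" "h' \<in> H" "a = h + nat_mult j x" "b = h' + nat_mult j' x"
        using ab unfolding H'_def by blast
      then show ?thesis using \<chi> Hadd
        by (simp add: comb val power_add char_on_def)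
    qed
    moreover have "cmod (\<chi>' a) = 1" if "a \<in> H'" for a
      using that val \<chi> cw unfolding H'_def char_on_def by (auto simp: norm_mult norm_power)
    ultimately show "char_on H' \<chi>'" by (simp add: char_on_def)
    have in_H': "h + nat_mult j x \<in> H'" if "h \<in> H" for h j
      unfolding H'_def using that by blast
    show "H \<subseteq> H'" using in_H'[of _ 0] by auto
    show "x \<in> H'" using in_H'[OF H0, of 1] by simp
    show "\<chi>' h = \<chi> h" if "h \<in> H" for h using val[OF that, of 0] by simp
    show "\<chi>' x = w" using val[OF H0, of 1] char_on_zero[OF H \<chi>] by simp
  qed
qed

text \<open>Adjoining one missing element at a time strictly shrinks the complement of
  \<open>H\<close>, which is the induction measure.\<close>

lemma char_on_extend:
  fixes H :: "'g::{finite, ab_group_add} set"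
  assumes "subgrp H" "char_on H \<chi>"
  shows "\<exists>\<psi>\<in>pontryagin_dual. \<forall>h\<in>H. \<psi> h = \<chi> h"
  using assms
proof (induction "card (- H)" arbitrary: H \<chi> rule: less_induct)
  case less
  show ?case
  proof (cases "H = UNIV")
    case True
    with less.prems show ?thesis by (auto simp: char_on_def pontryagin_dual_def)
  next
    case False
    then obtain x where x: "x \<notin> H" by blast
    obtain k where k: "k > 0" "nat_mult k x \<in> H" "\<And>j. nat_mult j x \<in> H \<Longrightarrow> k dvd j"
      using subgrp_multiples[OF less.prems(1)] by metis
    let ?z = "\<chi> (nat_mult k x)"
    have "cmod ?z = 1" using less.prems k(2) by (simp add: char_on_def)
    \<comment> \<open>Polar form of a unimodular number; dividing the argument by \<open>k\<close>
      yields a \<open>k\<close>-th root.\<close>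
    then have "cis (Arg ?z) = ?z" by (subst cis_Arg) (auto simp: sgn_eq)
    then have w: "cis (Arg ?z / real k) ^ k = ?z"
      using k(1) by (simp add: DeMoivre)
    obtain H' \<chi>' where H': "subgrp H'" "char_on H' \<chi>'" "H \<subseteq> H'" "x \<in> H'"
      "\<And>h. h \<in> H \<Longrightarrow> \<chi>' h = \<chi> h"
      using char_on_extend_step[OF less.prems k w] by metis
    have "card (- H') < card (- H)"
      using H'(3,4) x by (intro psubset_card_mono) auto
    from less.hyps[OF this H'(1,2)] H'(3,5) show ?thesis by (metis subsetD)
  qed
qed

text \<open>Over the trivial subgroup, \<open>k\<close> is the order of \<open>a\<close>. A
  primitive \<open>k\<close>-th root of unity is an admissible value at \<open>a\<close>, and it
  differs from 1 because \<open>k\<close> is at least 2.\<close>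

lemma dual_separates:
  fixes a :: "'g::{finite, ab_group_add}"
  assumes "a \<noteq> 0"
  shows "\<exists>\<psi>\<in>pontryagin_dual. \<psi> a \<noteq> 1"
proof -
  have H: "subgrp {0::'g}" and c: "char_on {0::'g} (\<lambda>_. 1)"
    by (auto simp: subgrp_def char_on_def)
  obtain k where k: "k > 0" "nat_mult k a \<in> {0}" "\<And>j. nat_mult j a \<in> {0} \<Longrightarrow> k dvd j"
    using subgrp_multiples[OF H] by metis
  have "k \<noteq> 1" using k(2) assms by auto
  then have "k \<ge> 2" using k(1) by simp
  define w where "w = cis (2 * pi / k)"
  have "w ^ k = 1" using k(1) by (simp add: w_def DeMoivre)
  have "w \<noteq> 1"
  proof
    assume "w = 1"
    \<comment> \<open>The exponents 0 and 1 are both below \<open>k\<close>, so they index distinct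
      \<open>k\<close>-th roots of unity.\<close>
    then have "cis (2 * pi * real 1 / real k) = cis (2 * pi * real 0 / real k)" by (simp add: w_def)
    then show False
      using bij_betw_imp_inj_on[OF bij_betw_roots_unity[OF k(1)]] \<open>k \<ge> 2\<close>
      by (auto dest!: inj_onD[of _ _ 1 0])
  qed
  obtain H' \<chi>' where H': "subgrp H'" "char_on H' \<chi>'" "a \<in> H'" "\<chi>' a = w"
    using char_on_extend_step[OF H c k \<open>w ^ k = 1\<close>] by metis
  from char_on_extend[OF H'(1,2)] H'(3,4) \<open>w \<noteq> 1\<close> show ?thesis by metis
qed

section \<open>The dual group: finiteness, orthogonality and order\<close>

lemma dual_zero: "\<chi> \<in> pontryagin_dual \<Longrightarrow> \<chi> 0 = 1"
  using char_on_zero[of UNIV \<chi>] by (simp add: subgrp_def char_on_def pontryagin_dual_def)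

lemma dual_add: "\<chi> \<in> pontryagin_dual \<Longrightarrow> \<chi> (a + b) = \<chi> a * \<chi> b"
  and dual_norm: "\<chi> \<in> pontryagin_dual \<Longrightarrow> cmod (\<chi> a) = 1"
  by (auto simp: pontryagin_dual_def)

lemma dual_diff:
  assumes "\<chi> \<in> pontryagin_dual"
  shows "\<chi> (a - b) = \<chi> a * cnj (\<chi> b)"
proof -
  have "\<chi> b * cnj (\<chi> b) = 1"
    using dual_norm[OF assms, of b] by (simp add: complex_norm_square[symmetric])
  moreover have "\<chi> (a - b) * \<chi> b = \<chi> a" using dual_add[OF assms, of "a - b" b] by simp
  ultimately show ?thesis by (metis mult.assoc mult.right_neutral)
qed

lemma dual_mult:
  "\<chi> \<in> pontryagin_dual \<Longrightarrow> \<psi> \<in> pontryagin_dual \<Longrightarrow> (\<lambda>a. \<chi> a * \<psi> a) \<in> pontryagin_dual"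
  by (auto simp: pontryagin_dual_def norm_mult)

lemma dual_cnj: "\<chi> \<in> pontryagin_dual \<Longrightarrow> (\<lambda>a. cnj (\<chi> a)) \<in> pontryagin_dual"
  by (auto simp: pontryagin_dual_def)

lemma dual_one: "(\<lambda>_. 1) \<in> pontryagin_dual"
  by (auto simp: pontryagin_dual_def)

text \<open>Every value of a character is a root of unity of order dividing \<open>CARD('g)\<close>:
  translating by \<open>a\<close> multiplies the nonzero product of all values by
  \<open>\<chi> a ^ CARD('g)\<close> while merely permuting its factors. So only finitely many
  functions are possible.\<close>

lemma finite_dual: "finite (pontryagin_dual :: ('g::{finite, ab_group_add} \<Rightarrow> complex) set)"
proof (rule finite_subset)
  show "finite (PiE (UNIV :: 'g set) (\<lambda>_. {z::complex. z ^ CARD('g) = 1}))"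
    by (intro finite_PiE finite_roots_unity) (auto simp: Suc_le_eq)
  have "\<chi> a ^ CARD('g) = 1" if "\<chi> \<in> pontryagin_dual" for \<chi> and a :: 'g
  proof -
    have "(\<Prod>y\<in>UNIV. \<chi> y) = (\<Prod>y\<in>UNIV. \<chi> (y + a))"
      using prod.reindex_bij_betw[OF bij_plus_right[of a], of \<chi>] by simp
    also have "\<dots> = (\<Prod>y\<in>UNIV. \<chi> y) * \<chi> a ^ CARD('g)"
      using that by (simp add: dual_add prod.distrib)
    finally have "(\<Prod>y\<in>UNIV. \<chi> y) * \<chi> a ^ CARD('g) = (\<Prod>y\<in>UNIV. \<chi> y)" by simp
    moreover have "(\<Prod>y\<in>UNIV. \<chi> y) \<noteq> 0"
      using dual_norm[OF that] by (metis (no_types) finite norm_zero prod_zero_iff zero_neq_one)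
    ultimately show ?thesis by simp
  qed
  then show "pontryagin_dual \<subseteq> PiE (UNIV :: 'g set) (\<lambda>_. {z::complex. z ^ CARD('g) = 1})"
    by auto
qed

text \<open>Translating by some \<open>b\<close> with \<open>\<chi> b\<close> different from 1
  permutes the summands but multiplies the sum by \<open>\<chi> b\<close>.\<close>

lemma sum_character:
  fixes \<chi> :: "'g::{finite, ab_group_add} \<Rightarrow> complex"
  assumes "\<chi> \<in> pontryagin_dual"
  shows "(\<Sum>a\<in>UNIV. \<chi> a) = (if \<chi> = (\<lambda>_. 1) then of_nat CARD('g) else 0)"
proof (cases "\<chi> = (\<lambda>_. 1)")
  case False
  then obtain b where b: "\<chi> b \<noteq> 1" by auto
  have "(\<Sum>a\<in>UNIV. \<chi> a) = (\<Sum>a\<in>UNIV. \<chi> (a + b))"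
    using sum.reindex_bij_betw[OF bij_plus_right[of b], of \<chi>] by simp
  also have "\<dots> = (\<Sum>a\<in>UNIV. \<chi> a) * \<chi> b"
    by (simp add: dual_add[OF assms] sum_distrib_right)
  finally show ?thesis using b False by simp
qed simp

text \<open>The dual form of the preceding argument: multiplication by a character
  \<open>\<psi>\<close> with \<open>\<psi> a\<close> different from 1 permutes the dual, its inverse
  being multiplication by the conjugate.\<close>

lemma sum_dual:
  fixes a :: "'g::{finite, ab_group_add}"
  assumes "a \<noteq> 0"
  shows "(\<Sum>\<chi>\<in>pontryagin_dual. \<chi> a) = 0"
proof -
  obtain \<psi> where \<psi>: "\<psi> \<in> pontryagin_dual" "\<psi> a \<noteq> 1"
    using dual_separates[OF assms] by blast
  have inv: "cnj (\<psi> b) * \<psi> b = 1" for b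
    using dual_norm[OF \<psi>(1), of b] by (simp add: mult.commute complex_norm_square[symmetric])
  have "bij_betw (\<lambda>\<chi> b. \<psi> b * \<chi> b) pontryagin_dual pontryagin_dual"
    using \<psi>(1) inv
    by (intro bij_betw_byWitness[where f' = "\<lambda>\<chi> b. cnj (\<psi> b) * \<chi> b"])
       (auto simp: dual_mult dual_cnj mult.assoc[symmetric] mult.commute[of "\<psi> _" "cnj _"])
  from sum.reindex_bij_betw[OF this, of "\<lambda>\<chi>. \<chi> a"]
  have "\<psi> a * (\<Sum>\<chi>\<in>pontryagin_dual. \<chi> a) = (\<Sum>\<chi>\<in>pontryagin_dual. \<chi> a)"
    by (simp add: sum_distrib_left)
  with \<psi>(2) show ?thesis by simp
qed

text \<open>In the double sum of all values, one order of summation leaves only the element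
  \<open>0\<close>, the other only the trivial character.\<close>

lemma card_dual: "card (pontryagin_dual :: ('g::{finite, ab_group_add} \<Rightarrow> complex) set) = CARD('g)"
proof -
  let ?S = "pontryagin_dual :: ('g \<Rightarrow> complex) set"
  have "(\<Sum>a\<in>UNIV. \<Sum>\<chi>\<in>?S. \<chi> a) = (\<Sum>a::'g\<in>UNIV. if a = 0 then of_nat (card ?S) else 0)"
    by (rule sum.cong[OF refl]) (auto simp: sum_dual dual_zero)
  also have "\<dots> = of_nat (card ?S)" by simp
  finally have 1: "(\<Sum>a\<in>UNIV. \<Sum>\<chi>\<in>?S. \<chi> a) = of_nat (card ?S)" .
  have "(\<Sum>\<chi>\<in>?S. \<Sum>a\<in>UNIV. \<chi> a) = (\<Sum>\<chi>\<in>?S. if \<chi> = (\<lambda>_. 1) then of_nat CARD('g) else 0)"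
    by (rule sum.cong[OF refl]) (auto simp: sum_character)
  also have "\<dots> = of_nat CARD('g)"
    using dual_one by (subst sum.delta[OF finite_dual]) simp
  finally have "(of_nat (card ?S) :: complex) = of_nat CARD('g)"
    using 1 sum.swap[of "\<lambda>a \<chi>. \<chi> a" ?S UNIV] by (simp only:)
  then show ?thesis by (simp only: of_nat_eq_iff)
qed

section \<open>Character sums over a difference set\<close>

lemma sum_character_difference_set:
  fixes D :: "'g::{finite, ab_group_add} set"
  assumes l: "\<And>g. g \<noteq> 0 \<Longrightarrow> card {(d, d'). d \<in> D \<and> d' \<in> D \<and> g = d - d'} = l"
    and \<chi>: "\<chi> \<in> pontryagin_dual" "\<chi> \<noteq> (\<lambda>_. 1)"
  shows "(cmod (\<Sum>d\<in>D. \<chi> d))\<^sup>2 = real (card D) - real l"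
proof -
  define N where "N g = card {(d, d'). d \<in> D \<and> d' \<in> D \<and> g = d - d'}" for g
  have "{(d, d'). d \<in> D \<and> d' \<in> D \<and> 0 = d - d'} = (\<lambda>d. (d, d)) ` D" by auto
  then have N0: "N 0 = card D" by (simp add: N_def card_image inj_on_def)
  have "complex_of_real ((cmod (\<Sum>d\<in>D. \<chi> d))\<^sup>2) = (\<Sum>d\<in>D. \<chi> d) * cnj (\<Sum>d\<in>D. \<chi> d)"
    by (rule complex_norm_square)
  also have "\<dots> = (\<Sum>(d,d')\<in>D \<times> D. \<chi> (d - d'))"
    by (simp add: sum_product sum.cartesian_product dual_diff[OF \<chi>(1)])
  \<comment> \<open>Pairs are grouped by their difference, so that the multiplicities
    \<open>N g\<close> appear.\<close>
  also have "\<dots> = (\<Sum>g\<in>UNIV. \<Sum>p\<in>{p \<in> D \<times> D. fst p - snd p = g}. \<chi> (fst p - snd p))"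
    by (subst sum.group) (auto simp: case_prod_beta)
  also have "\<dots> = (\<Sum>g\<in>UNIV. of_nat (N g) * \<chi> g)"
  proof (rule sum.cong[OF refl])
    fix g
    have "{p \<in> D \<times> D. fst p - snd p = g} = {(d, d'). d \<in> D \<and> d' \<in> D \<and> g = d - d'}" by auto
    moreover have "(\<Sum>p\<in>{p \<in> D \<times> D. fst p - snd p = g}. \<chi> (fst p - snd p)) =
        (\<Sum>p\<in>{p \<in> D \<times> D. fst p - snd p = g}. \<chi> g)"
      by (rule sum.cong) auto
    ultimately show "(\<Sum>p\<in>{p \<in> D \<times> D. fst p - snd p = g}. \<chi> (fst p - snd p)) = of_nat (N g) * \<chi> g"
      by (simp add: N_def)
  qed
  \<comment> \<open>Since \<open>N\<close> is \<open>l\<close> away from \<open>0\<close> and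
    \<open>card D\<close> at \<open>0\<close>, it is the constant \<open>l\<close> plus a correction
    at \<open>0\<close>. The constant part contributes nothing, as the nontrivial
    \<open>\<chi>\<close> sums to zero.\<close>
  also have "\<dots> = (\<Sum>g\<in>UNIV. of_nat l * \<chi> g + (if g = 0 then of_nat (card D) - of_nat l else 0))"
    using l N0 dual_zero[OF \<chi>(1)] by (intro sum.cong) (auto simp: N_def)
  also have "\<dots> = of_nat (card D) - of_nat l"
    using sum_character[OF \<chi>(1)] \<chi>(2) by (simp add: sum.distrib sum_distrib_left[symmetric])
  finally show ?thesis by (metis of_real_diff of_real_eq_iff of_real_of_nat_eq)
qed

section \<open>The harmonic ETF of a fixed difference set\<close>

context
  fixes D :: "'g::{finite, ab_group_add} set" and m n :: nat
    and g :: "nat \<Rightarrow> 'g" and \<gamma> :: "nat \<Rightarrow> 'g \<Rightarrow> complex" and i :: "nat \<Rightarrow> nat"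
  assumes D: "difference_set D" "D \<noteq> {}" "card D = m" and n: "CARD('g) = n"
    and \<gamma>: "bij_betw \<gamma> {..<n} (pontryagin_dual :: ('g \<Rightarrow> complex) set)"
    and gi: "bij_betw (\<lambda>k. g (i k)) {..<m} D"
begin

private definition "\<Phi> = mat m n (\<lambda>(k, j). complex_of_real (1 / sqrt (real m)) * \<gamma> j (g (i k)))"

private lemma \<Phi>_dim [simp]: "\<Phi> \<in> carrier_mat m n" "dim_row \<Phi> = m" "dim_col \<Phi> = n"
  by (simp_all add: \<Phi>_def)

private lemma \<Phi>_index:
  "k < m \<Longrightarrow> j < n \<Longrightarrow> \<Phi> $$ (k, j) = complex_of_real (1 / sqrt (real m)) * \<gamma> j (g (i k))"
  by (simp add: \<Phi>_def)

private lemma m_pos: "m > 0"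
  using D by (metis card_gt_0_iff finite)

private lemma \<gamma>_dual: "j < n \<Longrightarrow> \<gamma> j \<in> pontryagin_dual"
  using \<gamma> by (auto dest: bij_betwE)

private lemma synthesis: "mat_of_cols m (harmonic_ETF m n g \<gamma> i) = \<Phi>"
  using mat_of_cols_cols[of \<Phi>] by (simp add: harmonic_ETF_def \<Phi>_def)

private lemma length_harmonic: "length (harmonic_ETF m n g \<gamma> i) = n"
  by (simp add: harmonic_ETF_def)

private lemma nth_harmonic:
  "j < n \<Longrightarrow> harmonic_ETF m n g \<gamma> i ! j = vec m (\<lambda>k. complex_of_real (1 / sqrt (real m)) * \<gamma> j (g (i k)))"
  by (auto simp: harmonic_ETF_def)

private lemma adjoint_index:
  "j < n \<Longrightarrow> k < m \<Longrightarrow> mat_adjoint \<Phi> $$ (j, k) = complex_of_real (1 / sqrt (real m)) * cnj (\<gamma> j (g (i k)))"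
  by (simp add: mat_adjoint_def mat_of_rows_def \<Phi>_index)

private lemma adjoint_dim: "dim_row (mat_adjoint \<Phi>) = n" "dim_col (mat_adjoint \<Phi>) = m"
  by (simp_all add: mat_adjoint_def mat_of_rows_def)

private lemma scale_sq:
  "complex_of_real (1 / sqrt (real m)) * complex_of_real (1 / sqrt (real m)) = complex_of_real (1 / real m)"
  unfolding of_real_mult[symmetric] by simp

private lemma sum_\<gamma>: "(\<Sum>j<n. \<gamma> j a) = (if a = 0 then of_nat n else 0)"
proof -
  have "(\<Sum>j<n. \<gamma> j a) = (\<Sum>\<chi>\<in>pontryagin_dual. \<chi> a)"
    by (rule sum.reindex_bij_betw[OF \<gamma>])
  also have "\<dots> = (if a = 0 then of_nat n else 0)"
    by (auto simp: sum_dual dual_zero card_dual n)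
  finally show ?thesis .
qed

text \<open>The inner product of two rows is \<open>1 / m\<close> times the sum of all characters at
  \<open>g (i k) - g (i k')\<close>, which vanishes unless the rows coincide.\<close>

private lemma harmonic_tight:
  "\<Phi> * mat_adjoint \<Phi> = complex_of_real (real n / real m) \<cdot>\<^sub>m 1\<^sub>m m"
proof (rule eq_matI)
  fix k k' assume "k < dim_row (complex_of_real (real n / real m) \<cdot>\<^sub>m 1\<^sub>m m)"
    "k' < dim_col (complex_of_real (real n / real m) \<cdot>\<^sub>m (1\<^sub>m m :: complex mat))"
  then have k: "k < m" "k' < m" by auto
  have "(\<Phi> * mat_adjoint \<Phi>) $$ (k, k') = (\<Sum>j<n. \<Phi> $$ (k, j) * mat_adjoint \<Phi> $$ (j, k'))"
    using k by (simp add: adjoint_dim scalar_prod_def atLeast0LessThan)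
  also have "\<dots> = (\<Sum>j<n. complex_of_real (1 / real m) * \<gamma> j (g (i k) - g (i k')))"
  proof (rule sum.cong[OF refl])
    fix j assume "j \<in> {..<n}"
    then show "\<Phi> $$ (k, j) * mat_adjoint \<Phi> $$ (j, k') =
        complex_of_real (1 / real m) * \<gamma> j (g (i k) - g (i k'))"
      using k by (simp add: \<Phi>_index adjoint_index dual_diff[OF \<gamma>_dual] scale_sq[symmetric] del: of_real_divide)
  qed
  also have "\<dots> = complex_of_real (1 / real m) * (if g (i k) - g (i k') = 0 then of_nat n else 0)"
    by (simp only: sum_distrib_left[symmetric] sum_\<gamma>)
  also have "g (i k) - g (i k') = 0 \<longleftrightarrow> k = k'"
    using bij_betw_imp_inj_on[OF gi] k by (auto dest: inj_onD)
  finally show "(\<Phi> * mat_adjoint \<Phi>) $$ (k, k') =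
      (complex_of_real (real n / real m) \<cdot>\<^sub>m 1\<^sub>m m) $$ (k, k')"
    using k by simp
qed (auto simp: adjoint_dim)

text \<open>The quotient \<open>\<psi>\<close> of two distinct characters in the enumeration is a
  nontrivial character, and the inner product of their columns is \<open>1 / m\<close> times the sum
  of \<open>\<psi>\<close> over \<open>D\<close>, whose modulus does not depend on
  \<open>\<psi>\<close>.\<close>

private lemma harmonic_equiangular:
  "\<exists>c. \<forall>j<n. \<forall>j'<n. j \<noteq> j' \<longrightarrow>
     cmod (harmonic_ETF m n g \<gamma> i ! j \<bullet>c harmonic_ETF m n g \<gamma> i ! j') = c"
proof -
  obtain l where l: "\<And>g. g \<noteq> 0 \<Longrightarrow> card {(d, d'). d \<in> D \<and> d' \<in> D \<and> g = d - d'} = l"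
    using D(1) unfolding difference_set_def by blast
  have "cmod (harmonic_ETF m n g \<gamma> i ! j \<bullet>c harmonic_ETF m n g \<gamma> i ! j') =
      sqrt (real m - real l) / real m" if j: "j < n" "j' < n" "j \<noteq> j'" for j j'
  proof -
    define \<psi> where "\<psi> a = \<gamma> j a * cnj (\<gamma> j' a)" for a
    have \<psi>: "\<psi> \<in> pontryagin_dual"
      unfolding \<psi>_def using j by (intro dual_mult dual_cnj \<gamma>_dual)
    have "\<psi> \<noteq> (\<lambda>_. 1)"
    proof
      assume "\<psi> = (\<lambda>_. 1)"
      have "\<gamma> j a = \<gamma> j' a" for a
      proof -
        have "\<psi> a = 1" using \<open>\<psi> = (\<lambda>_. 1)\<close> by simp
        moreover have "cnj (\<gamma> j' a) * \<gamma> j' a = 1"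
          using dual_norm[OF \<gamma>_dual[OF j(2)], of a]
          by (simp add: mult.commute complex_norm_square[symmetric])
        ultimately show ?thesis unfolding \<psi>_def by (metis mult.assoc mult_1 mult.right_neutral)
      qed
      then show False using j bij_betw_imp_inj_on[OF \<gamma>] by (auto dest: inj_onD)
    qed
    have "harmonic_ETF m n g \<gamma> i ! j \<bullet>c harmonic_ETF m n g \<gamma> i ! j' =
        (\<Sum>k<m. complex_of_real (1 / real m) * \<psi> (g (i k)))"
      using j by (simp add: nth_harmonic scalar_prod_def atLeast0LessThan \<psi>_def
          scale_sq[symmetric] mult_ac del: of_real_divide)
    also have "\<dots> = complex_of_real (1 / real m) * (\<Sum>d\<in>D. \<psi> d)"
      by (simp only: sum_distrib_left[symmetric] sum.reindex_bij_betw[OF gi])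
    finally have "cmod (harmonic_ETF m n g \<gamma> i ! j \<bullet>c harmonic_ETF m n g \<gamma> i ! j') =
        cmod (\<Sum>d\<in>D. \<psi> d) / real m"
      by (simp add: norm_mult norm_divide)
    also have "cmod (\<Sum>d\<in>D. \<psi> d) = sqrt (real m - real l)"
      using sum_character_difference_set[OF l \<psi> \<open>\<psi> \<noteq> (\<lambda>_. 1)\<close>] D(3)
      by (metis norm_ge_zero real_sqrt_unique)
    finally show ?thesis .
  qed
  then show ?thesis by blast
qed

private lemma harmonic_is_ETF: "is_ETF m (harmonic_ETF m n g \<gamma> i)"
  unfolding is_ETF_def synthesis length_harmonic
proof (intro conjI)
  show "set (harmonic_ETF m n g \<gamma> i) \<subseteq> carrier_vec m"
    by (auto simp: harmonic_ETF_def cols_def)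
  have "vec_norm (harmonic_ETF m n g \<gamma> i ! j) = 1" if "j < n" for j
    using m_pos dual_norm[OF \<gamma>_dual[OF that]]
    by (simp add: nth_harmonic[OF that] vec_norm_def L2_set_def norm_mult norm_divide power_divide)
  then show "\<forall>j<n. vec_norm (harmonic_ETF m n g \<gamma> i ! j) = 1" by blast
  have "real n / real m > 0" using m_pos n by auto
  with harmonic_tight show "\<exists>\<alpha>>0. \<Phi> * mat_adjoint \<Phi> = complex_of_real \<alpha> \<cdot>\<^sub>m 1\<^sub>m m"
    by blast
qed (rule harmonic_equiangular)

lemma harmonic_axial:
  assumes "0 \<in> D"
  shows "axial_ETF m (harmonic_ETF m n g \<gamma> i)"
  unfolding axial_ETF_def synthesis length_harmonic
proof (intro conjI harmonic_is_ETF)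
  interpret V: vec_space "TYPE(complex)" n .
  obtain k where k: "k < m" "g (i k) = 0"
    using gi assms unfolding bij_betw_def by (metis imageE lessThan_iff)
  have sub: "set (cols (mat_adjoint \<Phi>)) \<subseteq> carrier_vec n"
    using adjoint_dim cols_dim[of "mat_adjoint \<Phi>"] by simp
  have "col (mat_adjoint \<Phi>) k \<in> set (cols (mat_adjoint \<Phi>))"
    using k(1) adjoint_dim by (simp add: cols_def)
  \<comment> \<open>Characters take the value 1 at \<open>0\<close>, so column \<open>k\<close> of
    the adjoint is constantly \<open>1 / sqrt m\<close>; the factor \<open>sqrt m\<close> turns it
    into the all-ones vector.\<close>
  then have "complex_of_real (sqrt (real m)) \<cdot>\<^sub>v col (mat_adjoint \<Phi>) k
      \<in> V.span (set (cols (mat_adjoint \<Phi>)))"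
    by (intro V.smult_in_span[OF sub] subsetD[OF V.in_own_span[OF sub]])
  moreover have "complex_of_real (sqrt (real m)) \<cdot>\<^sub>v col (mat_adjoint \<Phi>) k = all_ones n"
    using k m_pos
    by (intro eq_vecI) (auto simp: all_ones_def adjoint_dim adjoint_index dual_zero[OF \<gamma>_dual])
  ultimately show "all_ones n \<in> V.col_space (mat_adjoint \<Phi>)"
    by (simp add: V.col_space_def)
qed

lemma harmonic_centered:
  assumes "0 \<notin> D"
  shows "centered_ETF m (harmonic_ETF m n g \<gamma> i)"
  unfolding centered_ETF_def synthesis length_harmonic
proof (intro conjI harmonic_is_ETF)
  have "(\<Phi> *\<^sub>v all_ones n) $ k = 0" if "k < m" for k
  proof -
    have "g (i k) \<noteq> 0" using assms gi that by (metis bij_betwE lessThan_iff)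
    have "(\<Phi> *\<^sub>v all_ones n) $ k = (\<Sum>j<n. complex_of_real (1 / sqrt (real m)) * \<gamma> j (g (i k)))"
      using that by (simp add: \<Phi>_index all_ones_def scalar_prod_def atLeast0LessThan)
    also have "\<dots> = 0"
      using \<open>g (i k) \<noteq> 0\<close> by (simp only: sum_distrib_left[symmetric] sum_\<gamma>) simp
    finally show ?thesis .
  qed
  then have "\<Phi> *\<^sub>v all_ones n = 0\<^sub>v m" by (intro eq_vecI) auto
  then show "all_ones n \<in> mat_kernel \<Phi>"
    by (intro mat_kernelI[of _ m n]) (auto simp: all_ones_def)
qed

end

section \<open>Translates and existence\<close>

lemma difference_set_translate:
  fixes D :: "'g::{finite, ab_group_add} set"
  assumes "difference_set D"
  shows "difference_set ((\<lambda>d. d + t) ` D)"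
proof -
  have "card {(d, d'). d \<in> (\<lambda>d. d + t) ` D \<and> d' \<in> (\<lambda>d. d + t) ` D \<and> g = d - d'} =
      card {(d, d'). d \<in> D \<and> d' \<in> D \<and> g = d - d'}" for g
  proof -
    have "{(d, d'). d \<in> (\<lambda>d. d + t) ` D \<and> d' \<in> (\<lambda>d. d + t) ` D \<and> g = d - d'} =
        (\<lambda>(d, d'). (d + t, d' + t)) ` {(d, d'). d \<in> D \<and> d' \<in> D \<and> g = d - d'}"
      by (auto simp: image_iff)
    then show ?thesis by (simp add: card_image inj_on_def)
  qed
  with assms show ?thesis by (simp add: difference_set_def)
qed

lemma harmonic_enumerations:
  fixes D :: "'g::{finite, ab_group_add} set"
  obtains g :: "nat \<Rightarrow> 'g" and \<gamma> and i :: "nat \<Rightarrow> nat" where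
    "bij_betw \<gamma> {..<CARD('g)} (pontryagin_dual :: ('g \<Rightarrow> complex) set)"
    "bij_betw (\<lambda>k. g (i k)) {..<card D} D"
proof -
  obtain \<gamma> where "bij_betw \<gamma> {..<CARD('g)} (pontryagin_dual :: ('g \<Rightarrow> complex) set)"
    using ex_bij_betw_nat_finite[OF finite_dual] by (metis card_dual atLeast0LessThan)
  moreover obtain g where "bij_betw g {..<card D} D"
    using ex_bij_betw_nat_finite[of D] by (metis finite atLeast0LessThan)
  \<comment> \<open>With the identity as \<open>i\<close>, the function \<open>g\<close> may list
    \<open>D\<close> directly.\<close>
  ultimately show ?thesis using that[of \<gamma> g "\<lambda>k. k"] by simp
qed

lemma ex_harmonic:
  fixes D :: "'g::{finite, ab_group_add} set"
  assumes "difference_set D" "D \<noteq> {}"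
  shows "\<exists>\<phi>. length \<phi> = CARD('g) \<and>
    (if 0 \<in> D then axial_ETF (card D) \<phi> else centered_ETF (card D) \<phi>)"
proof -
  obtain g :: "nat \<Rightarrow> 'g" and \<gamma> and i :: "nat \<Rightarrow> nat" where *: "bij_betw \<gamma> {..<CARD('g)} (pontryagin_dual :: ('g \<Rightarrow> complex) set)"
    "bij_betw (\<lambda>k. g (i k)) {..<card D} D"
    by (rule harmonic_enumerations)
  have "length (harmonic_ETF (card D) CARD('g) g \<gamma> i) = CARD('g)"
    by (simp add: harmonic_ETF_def)
  with harmonic_axial[OF assms refl refl *(1), where g = g and i = i, OF *(2)]
    harmonic_centered[OF assms refl refl *(1), where g = g and i = i, OF *(2)]
  show ?thesis by metis
qed

theorem theorem3p4:
  shows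
    "(\<forall>(D :: 'g::{finite, ab_group_add} set) m n g \<gamma> i.
        difference_set D \<and> D \<noteq> {} \<and> card D = m \<and> CARD('g) = n \<and>
        bij_betw g {..<n} (UNIV :: 'g set) \<and>
        bij_betw \<gamma> {..<n} (pontryagin_dual :: ('g \<Rightarrow> complex) set) \<and>
        i ` {..<m} \<subseteq> {..<n} \<and> bij_betw (\<lambda>k. g (i k)) {..<m} D \<longrightarrow>
          (0 \<in> D \<longrightarrow> axial_ETF m (harmonic_ETF m n g \<gamma> i)) \<and>
          (0 \<notin> D \<longrightarrow> centered_ETF m (harmonic_ETF m n g \<gamma> i)))
     \<and>
     (\<forall>m n. 1 \<le> m \<and> m < n \<and> CARD('g) = n \<and>
        (\<exists>D :: 'g set. difference_set D \<and> card D = m) \<longrightarrow>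
          (\<exists>\<phi>. length \<phi> = n \<and> centered_ETF m \<phi>) \<and>
          (\<exists>\<phi>. length \<phi> = n \<and> axial_ETF m \<phi>))"
proof (intro conjI allI impI; (elim conjE exE)?)
  fix m n and D :: "'g set"
  assume mn: "1 \<le> m" "m < n" "CARD('g) = n" and D: "difference_set D" "card D = m"
  let ?T = "\<lambda>t. (\<lambda>d. d + t) ` D"
  have T: "difference_set (?T t)" "?T t \<noteq> {}" "card (?T t) = m" for t
    using D mn by (auto simp: difference_set_translate card_image)
  \<comment> \<open>As \<open>m < n\<close>, some \<open>a\<close> lies outside \<open>D\<close>;
    translating by \<open>- a\<close> sends \<open>a\<close> to \<open>0\<close>, which therefore
    lies outside the translate.\<close>
  have "D \<noteq> UNIV" using D mn by auto
  then obtain a where "a \<notin> D" by blast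
  then have "0 \<notin> ?T (- a)" by auto
  then show "\<exists>\<phi>. length \<phi> = n \<and> centered_ETF m \<phi>"
    using ex_harmonic[OF T(1,2), of "- a"] T(3)[of "- a"] mn(3) by simp
next
  fix m n and D :: "'g set"
  assume mn: "1 \<le> m" "m < n" "CARD('g) = n" and D: "difference_set D" "card D = m"
  let ?T = "\<lambda>t. (\<lambda>d. d + t) ` D"
  have T: "difference_set (?T t)" "?T t \<noteq> {}" "card (?T t) = m" for t
    using D mn by (auto simp: difference_set_translate card_image)
  \<comment> \<open>As \<open>m\<close> is at least 1, \<open>D\<close> has an element
    \<open>d\<close>, and translating by \<open>- d\<close> puts \<open>0\<close> into the
    translate.\<close>
  obtain d where "d \<in> D" using D mn by fastforce
  then have "0 \<in> ?T (- d)" by (auto simp: image_iff intro!: bexI[of _ d])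
  then show "\<exists>\<phi>. length \<phi> = n \<and> axial_ETF m \<phi>"
    using ex_harmonic[OF T(1,2), of "- d"] T(3)[of "- d"] mn(3) by simp
qed (auto intro: harmonic_axial harmonic_centered)

end
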